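(* Let $X$ be a sequentially weakly closed subset of a reflexive and separable real Banach space $E$, let $k$ be a positive integer, and let $\Phi:X\to\mathbf R$, $\Psi:X\to\,]-\infty,+\infty]$ be two functionals. Assume that there is a real number $\rho>\inf_X\Psi$ such that the set $\Psi^{-1}(]-\infty,\rho[)$ is bounded. Moreover, suppose that $\Phi$ is bounded below in $(\overline{\Psi^{-1}(]-\infty,\rho[)})_w$ and that the functional $\Psi+\lambda\Phi$ is sequentially weakly lower semicontinuous for each $\lambda\ge0$ small enough. Finally, assume that the set $\Psi^{-1}(\inf_X\Psi)$ has at least $k$ weakly connected components. Then there exists $\lambda^*>0$ such that, for each $\lambda\in\,]0,\lambda^*[$, the functional $\Psi+\lambda\Phi$ has at least $k$ $\tau_\Psi$-local minima lying in $\Psi^{-1}(]-\infty,\rho[)$, where $\tau$ is the relative weak topology of $X$.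
   Context: For a set $A$ in a Banach space, $(\overline A)_w$ denotes its closure in the weak topology; the weakly connected components of $A$ are its connected components in the weak topology. For a topology $\tau$ on $X$ and $\Psi:X\to\,]-\infty,+\infty]$ not identically $+\infty$, $\tau_\Psi$ denotes the smallest topology on $X$ containing both $\tau$ and the family of sets $\{\Psi^{-1}(]-\infty,s[)\}_{s\in\mathbf R}$. A $\tau_\Psi$-local minimum of a function $F$ on $X$ is a point $x\in X$ such that $F(x)\le F(y)$ for all $y$ in some $\tau_\Psi$-neighbourhood of $x$. "For each $\lambda\ge0$ small enough" means: there is $\lambda'>0$ such that the property holds for all $\lambda\in[0,\lambda']$. *)

theory Defs
  imports "HOL-Analysis.Analysis"
begin

definition weak_topology :: "'a::real_normed_vector topology" where
  "weak_topology =
     topology_generated_by {blinfun_apply f -` U | (f :: 'a \<Rightarrow>\<^sub>L real) U. open U}"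

lemma topspace_weak_topology [simp]: "topspace weak_topology = UNIV"
proof -
  have "blinfun_apply (0 :: 'a \<Rightarrow>\<^sub>L real) -` UNIV
          \<in> {blinfun_apply f -` U | (f :: 'a \<Rightarrow>\<^sub>L real) U. open U}"
    using open_UNIV by blast
  then show ?thesis
    unfolding weak_topology_def topology_generated_by_topspace by auto
qed

definition bidual_embedding ::
    "'a::real_normed_vector \<Rightarrow> (('a \<Rightarrow>\<^sub>L real) \<Rightarrow>\<^sub>L real)" where
  "bidual_embedding x = Blinfun (\<lambda>f. blinfun_apply f x)"

lemma bidual_embedding_apply [simp]:
  "blinfun_apply (bidual_embedding x) f = blinfun_apply f x"
  unfolding bidual_embedding_def
  by (simp add: bounded_linear_Blinfun_apply blinfun.bounded_linear_left)

definition reflexive_space :: "'a::real_normed_vector itself \<Rightarrow> bool" where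
  "reflexive_space _ \<longleftrightarrow>
     surj (bidual_embedding :: 'a \<Rightarrow> (('a \<Rightarrow>\<^sub>L real) \<Rightarrow>\<^sub>L real))"

definition sequentially_closedin :: "'a topology \<Rightarrow> 'a set \<Rightarrow> bool" where
  "sequentially_closedin T A \<longleftrightarrow> A \<subseteq> topspace T \<and>
     (\<forall>u x. range u \<subseteq> A \<and> limitin T u x sequentially \<longrightarrow> x \<in> A)"

definition sequentially_lsc :: "'a topology \<Rightarrow> ('a \<Rightarrow> ereal) \<Rightarrow> bool" where
  "sequentially_lsc T F \<longleftrightarrow>
     (\<forall>u x. range u \<subseteq> topspace T \<and> limitin T u x sequentially \<longrightarrow>
        F x \<le> liminf (\<lambda>n. F (u n)))"

text \<open>
  The topology \<open>\<tau>\<^sub>\<Psi>\<close>: the coarsest topology on the space of \<open>T\<close> containing both \<open>T\<close> and the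
  sublevel sets \<open>\<Psi>\<^sup>-\<^sup>1(]-\<infinity>,s[)\<close> for real \<open>s\<close>.
\<close>
definition sublevel_topology :: "'a topology \<Rightarrow> ('a \<Rightarrow> ereal) \<Rightarrow> 'a topology" where
  "sublevel_topology T \<Psi> =
     topology_generated_by
       ({U. openin T U} \<union> {{x \<in> topspace T. \<Psi> x < ereal s} | s :: real. True})"

definition local_minimum_in :: "'a topology \<Rightarrow> ('a \<Rightarrow> ereal) \<Rightarrow> 'a \<Rightarrow> bool" where
  "local_minimum_in T F x \<longleftrightarrow> (\<exists>U. openin T U \<and> x \<in> U \<and> (\<forall>y \<in> U. F x \<le> F y))"

text \<open>The set may be infinite, so \<open>k \<le> card A\<close> would not do.\<close>
definition has_at_least :: "nat \<Rightarrow> 'a set \<Rightarrow> bool" where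
  "has_at_least k A \<longleftrightarrow> (\<exists>B \<subseteq> A. finite B \<and> card B = k)"

end

theory Submission
  imports Defs
begin

text \<open>
  Let \<open>m = inf \<Psi>\<close> and let \<open>M\<close> be the set of minimisers of \<open>\<Psi>\<close>. A space with at least \<open>k\<close>
  connected components splits into \<open>k\<close> disjoint nonempty clopen pieces
  (\<open>open_partition_of_many_components\<close>); apply this to \<open>M\<close>. The pieces are weakly compact, so they
  have disjoint weakly open neighbourhoods \<open>V\<^sub>1, \<dots>, V\<^sub>k\<close>. The sublevel sets \<open>{\<Psi> \<le> r}\<close>
  shrink to \<open>M\<close> as \<open>r\<close> decreases to \<open>m\<close>, and by compactness one of them, with \<open>m < r < \<rho>\<close>, is
  already contained in the union of the \<open>V\<^sub>i\<close>. Each \<open>C\<^sub>i = {\<Psi> \<le> r} \<inter> V\<^sub>i\<close> is then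
  sequentially weakly compact, because it is also \<open>{\<Psi> \<le> r}\<close> with the other \<open>V\<^sub>j\<close> removed. Hence
  \<open>\<Psi> + \<lambda>\<Phi>\<close> attains its minimum over \<open>C\<^sub>i\<close> at some \<open>x\<^sub>i\<close>. Comparing with a
  point of \<open>M \<inter> V\<^sub>i\<close> and using the lower bound of \<open>\<Phi>\<close> gives \<open>\<Psi> x\<^sub>i \<le> m + O(\<lambda>)\<close>, so
  for small \<open>\<lambda>\<close> the strict inequality \<open>\<Psi> x\<^sub>i < r\<close> holds. The set \<open>{\<Psi> < r} \<inter> V\<^sub>i\<close> is then a
  \<open>\<tau>\<^sub>\<Psi>\<close>-neighbourhood of \<open>x\<^sub>i\<close> inside \<open>C\<^sub>i\<close>, which makes \<open>x\<^sub>i\<close> a local minimum. The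
  \<open>x\<^sub>i\<close> are distinct since the \<open>V\<^sub>i\<close> are disjoint. This argument is
  \<open>local_minima_from_components\<close>.

  The hypotheses on the space \<open>E\<close> enter through \<open>weak_coordinates_exist\<close>. Separability gives a
  sequence of functionals \<open>F\<^sub>n\<close> that distinguishes any two points distinguished by the dual,
  and reflexivity with Tychonoff's theorem gives weak compactness of balls. The map
  \<open>e x = (F\<^sub>n x)\<^sub>n\<close> into the metrisable space \<open>nat \<Rightarrow> real\<close> therefore detects weak convergence of
  bounded sequences, so compactness, closed sets and separating neighbourhoods can all be handled
  by sequences in a metric space. It is injective only up to points that no functional
  distinguishes; these are exactly the topologically indistinguishable points of the weak topology,
  so that open sets and limits do not see the difference.
\<close>

section \<open>Clopen partitions\<close>

text \<open>
  Induction on \<open>k\<close>. If all \<open>k\<close> pieces of a partition were connected, every component would contain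
  one of them, and different components different ones; so with \<open>k + 1\<close> components some piece is
  disconnected and can be split. Each member of such a partition is also closed, being the
  complement of the union of the others.
\<close>

lemma open_partition_of_many_components:
  assumes "has_at_least k (connected_components_of T)" and "k > 0"
  shows "\<exists>\<P>. finite \<P> \<and> card \<P> = k \<and> \<Union>\<P> = topspace T \<and> disjoint \<P> \<and>
           (\<forall>P\<in>\<P>. openin T P \<and> P \<noteq> {})"
  using assms
proof (induction k)
  case 0
  then show ?case by simp
next
  case (Suc k)
  obtain B where B: "B \<subseteq> connected_components_of T" "finite B" "card B = Suc k"
    using Suc.prems unfolding has_at_least_def by blast
  show ?case
  proof (cases "k = 0")
    case True
    then obtain C where "C \<in> connected_components_of T"
      using B by fastforce
    then have "topspace T \<noteq> {}"
      using Union_connected_components_of[of T] nonempty_connected_components_of[of C T] by blast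
    then show ?thesis
      by (intro exI[of _ "{topspace T}"]) (simp add: True pairwise_def)
  next
    case False
    obtain b where "b \<in> B" using B by fastforce
    then have "card (B - {b}) = k" using B by simp
    then have "has_at_least k (connected_components_of T)"
      unfolding has_at_least_def using B by (metis Diff_subset finite_Diff subset_trans)
    then obtain \<P> where P: "finite \<P>" "card \<P> = k" "\<Union>\<P> = topspace T" "disjoint \<P>"
      "\<And>P. P \<in> \<P> \<Longrightarrow> openin T P \<and> P \<noteq> {}"
      using Suc.IH False by blast
    have "\<exists>P\<in>\<P>. \<not> connectedin T P"
    proof (rule ccontr)
      assume conn: "\<not> (\<exists>P\<in>\<P>. \<not> connectedin T P)"
      have "\<exists>P\<in>\<P>. P \<subseteq> C" if C: "C \<in> B" for C
      proof -
        have CT: "C \<in> connected_components_of T" using C B by blast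
        then obtain x where x: "x \<in> C" "x \<in> topspace T"
          using Union_connected_components_of[of T] nonempty_connected_components_of[of C T]
          by blast
        then obtain P where "P \<in> \<P>" "x \<in> P" using P(3) by blast
        with conn connected_components_of_maximal[OF CT, of P] x show ?thesis
          by (auto simp: disjnt_def)
      qed
      then obtain g where g: "\<And>C. C \<in> B \<Longrightarrow> g C \<in> \<P> \<and> g C \<subseteq> C" by metis
      have "inj_on g B"
      proof (rule inj_onI)
        fix C D assume CD: "C \<in> B" "D \<in> B" "g C = g D"
        then have "g C \<noteq> {}" "g C \<subseteq> C" "g C \<subseteq> D" using g P(5) by (metis, metis, metis)
        then have "\<not> disjnt C D" by (auto simp: disjnt_def)
        then show "C = D"
          using pairwise_disjoint_connected_components_of[of T] B CD
          by (meson pairwiseD subsetD)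
      qed
      then have "card B \<le> card \<P>"
        using card_inj_on_le[of g B \<P>] g P(1) by blast
      then show False using B P by simp
    qed
    then obtain P where PP: "P \<in> \<P>" "\<not> connectedin T P" by blast
    have PT: "P \<subseteq> topspace T" using PP P(3) by blast
    obtain E1 E2 where E: "openin T E1" "openin T E2" "P \<subseteq> E1 \<union> E2" "E1 \<inter> E2 \<inter> P = {}"
      "E1 \<inter> P \<noteq> {}" "E2 \<inter> P \<noteq> {}"
      using PP(2) PT unfolding connectedin by blast
    define Q where "Q = insert (E1 \<inter> P) (insert (E2 \<inter> P) (\<P> - {P}))"
    have dis: "S \<inter> P = {}" if "S \<in> \<P> - {P}" for S
      using P(4) PP(1) that by (auto simp: pairwise_def disjnt_def)
    have new: "E1 \<inter> P \<notin> \<P> - {P}" "E2 \<inter> P \<notin> \<P> - {P}" "E1 \<inter> P \<noteq> E2 \<inter> P"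
      using dis E by blast+
    have "card (\<P> - {P}) = k - 1" using PP P by simp
    then have "card Q = Suc k"
      using new P(1) False by (simp add: Q_def)
    moreover have "\<Union>Q = topspace T"
    proof -
      have "\<Union>Q = P \<union> \<Union>(\<P> - {P})" using E(3) by (auto simp: Q_def)
      also have "\<dots> = \<Union>(insert P (\<P> - {P}))" by (simp only: Union_insert)
      also have "\<dots> = topspace T" using PP(1) P(3) by (simp add: insert_absorb)
      finally show ?thesis .
    qed
    moreover have "disjoint Q"
    proof -
      have "disjoint (\<P> - {P})" using P(4) by (auto simp: pairwise_def)
      then show ?thesis
        unfolding Q_def pairwise_insert disjnt_def using dis E(4) by fast
    qed
    moreover have "\<forall>S\<in>Q. openin T S \<and> S \<noteq> {}"
      using P(5) PP E by (auto simp: Q_def)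
    ultimately show ?thesis
      using P(1) by (intro exI[of _ Q]) (simp add: Q_def)
  qed
qed

section \<open>Weak convergence\<close>

lemma continuous_map_weak_functional:
  "continuous_map weak_topology euclideanreal (blinfun_apply f)"
  unfolding continuous_map_def
proof (intro conjI ballI allI impI)
  fix U :: "real set" assume "openin euclidean U"
  then have "openin weak_topology (blinfun_apply f -` U)"
    unfolding weak_topology_def by (intro topology_generated_by_Basis) auto
  then show "openin weak_topology {x \<in> topspace weak_topology. blinfun_apply f x \<in> U}"
    by (simp add: vimage_def)
qed auto

lemma limitin_weak_iff:
  "limitin weak_topology u (x::'a::real_normed_vector) F \<longleftrightarrow>
     (\<forall>f :: 'a \<Rightarrow>\<^sub>L real. ((\<lambda>n. blinfun_apply f (u n)) \<longlongrightarrow> blinfun_apply f x) F)"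
proof
  assume lim: "limitin weak_topology u x F"
  show "\<forall>f :: 'a \<Rightarrow>\<^sub>L real. ((\<lambda>n. blinfun_apply f (u n)) \<longlongrightarrow> blinfun_apply f x) F"
    using continuous_map_limit[OF continuous_map_weak_functional lim] by (simp add: o_def)
next
  assume lim: "\<forall>f :: 'a \<Rightarrow>\<^sub>L real. ((\<lambda>n. blinfun_apply f (u n)) \<longlongrightarrow> blinfun_apply f x) F"
  have "x \<in> U \<longrightarrow> (\<forall>\<^sub>F n in F. u n \<in> U)" if "openin weak_topology U" for U
    using openin_topology_generated_by[OF that[unfolded weak_topology_def]]
  proof induction
    case (Basis s)
    then obtain f :: "'a \<Rightarrow>\<^sub>L real" and V where s: "s = blinfun_apply f -` V" and V: "open V"
      by blast
    show ?case using topological_tendstoD[OF lim[rule_format] V] by (simp add: s)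
  next
    case (UN K)
    show ?case
    proof
      assume "x \<in> \<Union>K"
      then obtain k where "k \<in> K" "x \<in> k" by blast
      then show "\<forall>\<^sub>F n in F. u n \<in> \<Union>K"
        using UN.IH by (intro eventually_mono[where P = "\<lambda>n. u n \<in> k" and Q = "\<lambda>n. u n \<in> \<Union>K"]) blast+
    qed
  qed (auto simp: eventually_conj)
  then show "limitin weak_topology u x F" by (simp add: limitin_def)
qed

lemma tendsto_coordinate:
  fixes g :: "'b \<Rightarrow> 'c \<Rightarrow> 'd::topological_space"
  assumes "(g \<longlongrightarrow> l) F"
  shows "((\<lambda>k. g k i) \<longlongrightarrow> l i) F"
  by (rule continuous_on_tendsto_compose[OF continuous_on_product_coordinates assms]) auto

text \<open>
  A functional is determined by its values on a dense sequence \<open>d\<close>, and the image of the dual unit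
  ball under \<open>f \<mapsto> (f (d n))\<^sub>n\<close> is separable, as a subset of a second countable space. A countable
  dense family in this image consists of functionals that approximate any \<open>f\<close> in the dual ball
  pointwise on \<open>d\<close>; being uniformly Lipschitz, they detect \<open>f x \<noteq> 0\<close> at every \<open>x\<close>.
\<close>

lemma countable_separating_functionals:
  assumes "separable_space (euclidean :: 'a::real_normed_vector topology)"
  shows "\<exists>F :: nat \<Rightarrow> 'a \<Rightarrow>\<^sub>L real. \<forall>x. (\<forall>n. blinfun_apply (F n) x = 0) \<longrightarrow>
           (\<forall>f :: 'a \<Rightarrow>\<^sub>L real. blinfun_apply f x = 0)"
proof -
  obtain D :: "'a set" where D: "countable D" "closure D = UNIV"
    using assms unfolding separable_space_def by auto
  then have "D \<noteq> {}" by auto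
  define d where "d = from_nat_into D"
  have d: "range d = D" unfolding d_def using D \<open>D \<noteq> {}\<close> by (simp add: range_from_nat_into)
  define h :: "('a \<Rightarrow>\<^sub>L real) \<Rightarrow> nat \<Rightarrow> real" where "h = (\<lambda>f n. blinfun_apply f (d n))"
  obtain T where T: "countable T" "T \<subseteq> h ` cball 0 1" "h ` cball 0 1 \<subseteq> closure T"
    using separable[of "h ` cball 0 1"] by blast
  have "h 0 \<in> closure T" using T(3) by force
  then have "T \<noteq> {}" by auto
  have "\<exists>f. norm f \<le> 1 \<and> h f = from_nat_into T n" for n
  proof -
    have "from_nat_into T n \<in> h ` cball 0 1" using from_nat_into[OF \<open>T \<noteq> {}\<close>] T(2) by blast
    then show ?thesis by (auto intro: sym)
  qed
  then obtain F where F: "\<And>n. norm (F n) \<le> 1" "\<And>n. h (F n) = from_nat_into T n" by metis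
  have T_range: "\<exists>n. g = h (F n)" if "g \<in> T" for g
    using that F(2) from_nat_into_surj[OF T(1)] by metis
  have "blinfun_apply f x = 0" if x: "\<And>n. blinfun_apply (F n) x = 0" for x and f :: "'a \<Rightarrow>\<^sub>L real"
  proof -
    have unit: "blinfun_apply f x = 0" if f: "norm f \<le> 1" for f :: "'a \<Rightarrow>\<^sub>L real"
    proof -
      obtain g where g: "\<And>k. g k \<in> T" "g \<longlonglongrightarrow> h f"
      proof -
        have "h f \<in> closure T" using T(3) f by auto
        then show ?thesis using that unfolding closure_sequential by blast
      qed
      have le: "\<bar>blinfun_apply f (d n)\<bar> \<le> norm (d n - x)" for n
      proof (rule LIMSEQ_le_const2)
        show "(\<lambda>k. \<bar>g k n\<bar>) \<longlonglongrightarrow> \<bar>blinfun_apply f (d n)\<bar>"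
          using tendsto_rabs[OF tendsto_coordinate[OF g(2), of n]] by (simp add: h_def)
        have "\<bar>g k n\<bar> \<le> norm (d n - x)" for k
        proof -
          obtain m where "g k = h (F m)" using T_range g(1) by blast
          then have "\<bar>g k n\<bar> = norm (blinfun_apply (F m) (d n - x))" by (simp add: h_def blinfun.diff_right x)
          also have "\<dots> \<le> norm (F m) * norm (d n - x)" by (rule norm_blinfun)
          also have "\<dots> \<le> norm (d n - x)" using F(1)[of m] by (simp add: mult_left_le_one_le)
          finally show ?thesis .
        qed
        then show "\<exists>N. \<forall>k\<ge>N. \<bar>g k n\<bar> \<le> norm (d n - x)" by blast
      qed
      obtain w where w: "\<And>k. w k \<in> D" "w \<longlonglongrightarrow> x"
      proof -
        have "x \<in> closure D" using D(2) by simp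
        then show ?thesis using that unfolding closure_sequential by blast
      qed
      have "\<bar>blinfun_apply f x\<bar> \<le> norm (x - x)"
      proof (rule LIMSEQ_le)
        show "(\<lambda>k. \<bar>blinfun_apply f (w k)\<bar>) \<longlonglongrightarrow> \<bar>blinfun_apply f x\<bar>" using w(2) by (intro tendsto_intros)
        show "(\<lambda>k. norm (w k - x)) \<longlonglongrightarrow> norm (x - x)" using w(2) by (intro tendsto_intros)
        show "\<exists>N. \<forall>k\<ge>N. \<bar>blinfun_apply f (w k)\<bar> \<le> norm (w k - x)" using le w(1) d by (metis rangeE)
      qed
      then show ?thesis by simp
    qed
    show ?thesis
    proof (cases "f = 0")
      case False
      then have "blinfun_apply (f /\<^sub>R norm f) x = 0" by (intro unit) simp
      then show ?thesis using False by (simp add: blinfun.scaleR_left)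
    qed simp
  qed
  then show ?thesis by blast
qed

text \<open>
  For \<open>R \<ge> 0\<close> this is the closed ball of radius \<open>R\<close>, by the Hahn--Banach theorem. In the form given
  here, the condition passes directly to pointwise limits of evaluations.
\<close>

definition dual_ball :: "real \<Rightarrow> 'a::real_normed_vector set" where
  "dual_ball R = {x. \<forall>f :: 'a \<Rightarrow>\<^sub>L real. \<bar>blinfun_apply f x\<bar> \<le> R * norm f}"

lemma cball_subset_dual_ball: "cball 0 R \<subseteq> dual_ball R"
proof
  fix x :: 'a assume "x \<in> cball 0 R"
  then have "\<bar>blinfun_apply f x\<bar> \<le> R * norm f" for f :: "'a \<Rightarrow>\<^sub>L real"
    using norm_blinfun[of f x] mult_left_mono[of "norm x" R "norm f"]
    by (simp add: mult.commute)
  then show "x \<in> dual_ball R" by (simp add: dual_ball_def)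
qed

text \<open>
  This is the Banach--Alaoglu argument on the bidual. The evaluations at points of the ball are
  exactly the linear functions in a product of compact intervals: such a function is a bounded
  functional on the dual, and reflexivity represents it by a point. Linearity is a closed
  condition, so Tychonoff's theorem applies.
\<close>

lemma compact_evaluations_dual_ball:
  assumes "reflexive_space TYPE('a::real_normed_vector)"
  shows "compact ((\<lambda>(x::'a) (f :: 'a \<Rightarrow>\<^sub>L real). blinfun_apply f x) ` dual_ball R)"
    (is "compact (?J ` _)")
proof -
  let ?box = "PiE UNIV (\<lambda>f :: 'a \<Rightarrow>\<^sub>L real. {- (R * norm f) .. R * norm f})"
  let ?lin = "{\<phi> :: ('a \<Rightarrow>\<^sub>L real) \<Rightarrow> real. (\<forall>f g. \<phi> (f + g) = \<phi> f + \<phi> g) \<and>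
                                             (\<forall>c f. \<phi> (c *\<^sub>R f) = c * \<phi> f)}"
  have "compactin (product_topology (\<lambda>_ :: 'a \<Rightarrow>\<^sub>L real. euclideanreal) UNIV) ?box"
    by (subst compactin_PiE) (auto simp: compact_Icc)
  then have "compact ?box" by (simp add: euclidean_product_topology)
  moreover have "closed ?lin"
    by (intro closed_Collect_conj closed_Collect_all closed_Collect_eq continuous_intros
        continuous_on_product_coordinates)
  ultimately have "compact (?box \<inter> ?lin)" by (rule compact_Int_closed)
  moreover have "?J ` dual_ball R = ?box \<inter> ?lin"
  proof (intro equalityI subsetI)
    fix \<phi> assume "\<phi> \<in> ?J ` dual_ball R"
    then obtain x where x: "\<phi> = ?J x" "x \<in> dual_ball R" by blast
    have "blinfun_apply f x \<in> {- (R * norm f) .. R * norm f}" for f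
    proof -
      have "\<bar>blinfun_apply f x\<bar> \<le> R * norm f" using x(2) by (simp add: dual_ball_def)
      then show ?thesis unfolding atLeastAtMost_iff by linarith
    qed
    then show "\<phi> \<in> ?box \<inter> ?lin"
      by (simp add: x(1) PiE_UNIV_domain blinfun.add_left blinfun.scaleR_left)
  next
    fix \<phi> assume phi: "\<phi> \<in> ?box \<inter> ?lin"
    have bound: "\<bar>\<phi> f\<bar> \<le> R * norm f" for f
    proof -
      have "\<phi> f \<in> {- (R * norm f) .. R * norm f}" using phi by blast
      then show ?thesis unfolding atLeastAtMost_iff by linarith
    qed
    have "bounded_linear \<phi>"
      using phi bound by (intro bounded_linear_intro[where K = R]) (auto simp: mult.commute)
    then have "blinfun_apply (Blinfun \<phi>) = \<phi>" by (rule bounded_linear_Blinfun_apply)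
    moreover obtain x :: 'a where "Blinfun \<phi> = bidual_embedding x"
      using assms unfolding reflexive_space_def by (rule surjE)
    ultimately have "blinfun_apply f x = \<phi> f" for f
      by (metis bidual_embedding_apply)
    then show "\<phi> \<in> ?J ` dual_ball R"
      using bound by (intro image_eqI[of _ _ x]) (auto simp: dual_ball_def)
  qed
  ultimately show ?thesis by simp
qed

text \<open>
  On the compact set of evaluations \<open>J x = (f x)\<^sub>f\<close>, restriction to the countably many coordinates
  \<open>F n\<close> is continuous and injective, hence a homeomorphism onto its image. So the coordinates
  \<open>F n\<close> alone control all functionals along sequences in a ball.
\<close>

lemma weak_coordinates_exist:
  assumes "reflexive_space TYPE('a::real_normed_vector)"
    and "separable_space (euclidean :: 'a topology)"
  shows "\<exists>e :: 'a \<Rightarrow> nat \<Rightarrow> real. continuous_map weak_topology euclidean e \<and>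
           (\<forall>x y. e x = e y \<longrightarrow> (\<forall>f :: 'a \<Rightarrow>\<^sub>L real. blinfun_apply f x = blinfun_apply f y)) \<and>
           (\<forall>R. compact (e ` dual_ball R)) \<and>
           (\<forall>R u x. range u \<subseteq> dual_ball R \<longrightarrow> (\<lambda>n. e (u n)) \<longlonglongrightarrow> e x \<longrightarrow>
              limitin weak_topology u x sequentially)"
proof -
  obtain F :: "nat \<Rightarrow> 'a \<Rightarrow>\<^sub>L real" where
    sep: "\<And>x (f :: 'a \<Rightarrow>\<^sub>L real). (\<forall>n. blinfun_apply (F n) x = 0) \<Longrightarrow> blinfun_apply f x = 0"
    using countable_separating_functionals[OF assms(2)] by blast
  define e where "e = (\<lambda>x n. blinfun_apply (F n) x)"
  define J where "J = (\<lambda>(x::'a) (f :: 'a \<Rightarrow>\<^sub>L real). blinfun_apply f x)"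
  define p where "p = (\<lambda>(\<phi> :: ('a \<Rightarrow>\<^sub>L real) \<Rightarrow> real) n. \<phi> (F n))"
  have pJ: "p (J x) = e x" for x by (simp add: p_def J_def e_def)
  have e_cont: "continuous_map weak_topology euclidean e"
    unfolding e_def
    by (subst euclidean_product_topology[symmetric])
      (simp add: continuous_map_componentwise_UNIV continuous_map_weak_functional)
  have eq: "blinfun_apply f x = blinfun_apply f y" if "e x = e y" for x y and f :: "'a \<Rightarrow>\<^sub>L real"
  proof -
    have "\<forall>n. blinfun_apply (F n) (x - y) = 0" using that by (simp add: e_def blinfun.diff_right fun_eq_iff)
    then have "blinfun_apply f (x - y) = 0" by (rule sep)
    then show ?thesis by (simp add: blinfun.diff_right)
  qed
  have p_cont: "continuous_on S p" for S
    unfolding p_def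
    by (intro continuous_on_coordinatewise_then_product continuous_on_subset[OF continuous_on_product_coordinates]) auto
  have Jc: "compact (J ` dual_ball R)" for R
    unfolding J_def by (rule compact_evaluations_dual_ball[OF assms(1)])
  have pim: "p ` J ` dual_ball R = e ` dual_ball R" for R by (auto simp: pJ image_iff)
  have ec: "compact (e ` dual_ball R)" for R
    using compact_continuous_image[OF p_cont Jc] pim by metis
  have lim: "limitin weak_topology u x sequentially"
    if u: "range u \<subseteq> dual_ball R" and lim: "(\<lambda>n. e (u n)) \<longlonglongrightarrow> e x" for R u x
  proof -
    have eu: "e (u n) \<in> e ` dual_ball R" for n using u by blast
    have x: "e x \<in> e ` dual_ball R"
      by (rule closed_sequentially[OF compact_imp_closed[OF ec] eu lim])
    \<comment> \<open>The inverse of \<open>p\<close> on the evaluations; the choice is harmless because points with equal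
      coordinates have equal evaluations.\<close>
    define q where "q = (\<lambda>z. J (SOME y. e y = z))"
    have qe: "q (e y) = J y" for y
    proof -
      have "e (SOME y'. e y' = e y) = e y" by (rule someI) simp
      then show ?thesis using eq unfolding q_def J_def by (auto simp: fun_eq_iff)
    qed
    have "continuous_on (p ` J ` dual_ball R) q"
      by (rule continuous_on_inv[OF p_cont Jc]) (auto simp: pJ qe)
    then have "continuous_on (e ` dual_ball R) q" by (simp add: pim)
    then have "(\<lambda>n. q (e (u n))) \<longlonglongrightarrow> q (e x)"
      by (rule continuous_on_tendsto_compose[OF _ lim x]) (simp add: eu)
    then have *: "(\<lambda>n. J (u n)) \<longlonglongrightarrow> J x" by (simp add: qe)
    have "(\<lambda>n. J (u n) f) \<longlonglongrightarrow> J x f" for f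
      by (rule tendsto_coordinate[OF *])
    then show ?thesis by (simp add: limitin_weak_iff J_def)
  qed
  show ?thesis
    by (intro exI[of _ e] conjI allI impI) (rule e_cont, erule eq, rule ec, erule (1) lim)
qed

section \<open>Local minima near the components of the set of minimisers\<close>

lemma separate_disjoint_closed_sets:
  fixes K :: "'i \<Rightarrow> 'm::metric_space set"
  assumes "finite I" and K: "\<And>i. i \<in> I \<Longrightarrow> closed (K i) \<and> K i \<noteq> {}"
    and disj: "\<And>i j. \<lbrakk>i \<in> I; j \<in> I; i \<noteq> j\<rbrakk> \<Longrightarrow> K i \<inter> K j = {}"
  shows "\<exists>V. (\<forall>i\<in>I. open (V i) \<and> K i \<subseteq> V i) \<and>
             (\<forall>i\<in>I. \<forall>j\<in>I. i \<noteq> j \<longrightarrow> V i \<inter> V j = {})"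
proof -
  \<comment> \<open>The points strictly closer to \<open>K i\<close> than to any other member of the family.\<close>
  define V where "V = (\<lambda>i. \<Inter>j\<in>I - {i}. {y. infdist y (K i) < infdist y (K j)})"
  have "open (V i)" for i
    unfolding V_def using assms(1)
    by (intro open_INT ballI open_Collect_less continuous_on_infdist continuous_on_id) auto
  moreover have "K i \<subseteq> V i" if i: "i \<in> I" for i
  proof
    fix y assume y: "y \<in> K i"
    have "infdist y (K i) < infdist y (K j)" if j: "j \<in> I" "i \<noteq> j" for j
    proof -
      have "y \<notin> K j" using disj[OF i j] y by blast
      then have "infdist y (K j) > 0"
        using in_closed_iff_infdist_zero[of "K j" y] K[OF j(1)] infdist_nonneg[of y "K j"]
        by linarith
      then show ?thesis using y by simp
    qed
    then show "y \<in> V i" by (auto simp: V_def)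
  qed
  moreover have "V i \<inter> V j = {}" if ij: "i \<in> I" "j \<in> I" "i \<noteq> j" for i j
  proof -
    have "False" if "y \<in> V i" "y \<in> V j" for y
    proof -
      have "infdist y (K i) < infdist y (K j)" "infdist y (K j) < infdist y (K i)"
        using that ij by (auto simp: V_def)
      then show False by linarith
    qed
    then show ?thesis by blast
  qed
  ultimately show ?thesis by blast
qed

lemma sequentially_lsc_le_lim:
  assumes "sequentially_lsc T F" "range u \<subseteq> topspace T" "limitin T u x sequentially"
    and "\<And>n. F (u n) \<le> c n" "c \<longlonglongrightarrow> c0"
  shows "F x \<le> c0"
proof -
  have "F x \<le> liminf (\<lambda>n. F (u n))" using assms(1-3) unfolding sequentially_lsc_def by blast
  also have "\<dots> \<le> liminf c" by (intro Liminf_mono always_eventually allI assms(4))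
  also have "\<dots> = c0" by (intro lim_imp_Liminf assms(5)) simp
  finally show ?thesis .
qed

text \<open>
  The variational part, in a space with just enough structure to argue by sequences: \<open>e\<close> is a
  continuous map to a metric space that is injective up to topologically indistinguishable points,
  and sequences in \<open>{\<Psi> < \<rho>}\<close> have convergent subsequences. The map \<open>e\<close> serves to separate the
  pieces of the set of minimisers by open sets, which are built in the metric space and
  pulled back.
\<close>

lemma local_minima_from_components:
  fixes T :: "'a topology" and e :: "'a \<Rightarrow> 'm::metric_space"
    and \<Phi> :: "'a \<Rightarrow> real" and \<Psi> :: "'a \<Rightarrow> ereal" and \<rho> m b l' :: real
  assumes e: "continuous_map T euclidean e"
    and indist: "\<And>x y U. \<lbrakk>x \<in> topspace T; e x = e y; openin T U; y \<in> U\<rbrakk> \<Longrightarrow> x \<in> U"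
    and seq_comp: "\<And>u. range u \<subseteq> {x \<in> topspace T. \<Psi> x < ereal \<rho>} \<Longrightarrow>
            \<exists>r x. strict_mono (r :: nat \<Rightarrow> nat) \<and> limitin T (u \<circ> r) x sequentially"
    and l': "l' > 0" and lsc: "\<And>l. l \<in> {0..l'} \<Longrightarrow> sequentially_lsc T (\<lambda>x. \<Psi> x + ereal (l * \<Phi> x))"
    and min: "\<And>x. x \<in> topspace T \<Longrightarrow> ereal m \<le> \<Psi> x" and m_less: "m < \<rho>"
    and below: "\<And>x. \<lbrakk>x \<in> topspace T; \<Psi> x < ereal \<rho>\<rbrakk> \<Longrightarrow> b \<le> \<Phi> x"
    and comps: "has_at_least k (connected_components_of
                  (subtopology T {x \<in> topspace T. \<Psi> x = ereal m}))" and "k > 0"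
  shows "\<exists>l\<^sub>0>0. \<forall>l\<in>{0<..<l\<^sub>0}. has_at_least k
           {x \<in> topspace T. \<Psi> x < ereal \<rho> \<and>
              local_minimum_in (sublevel_topology T \<Psi>) (\<lambda>y. \<Psi> y + ereal (l * \<Phi> y)) x}"
proof -
  define M where "M = {x \<in> topspace T. \<Psi> x = ereal m}"
  have MT: "M \<subseteq> topspace T" by (auto simp: M_def)
  have lsc0: "sequentially_lsc T \<Psi>"
    using lsc[of 0] l' by (simp flip: zero_ereal_def)
  have e_lim: "(\<lambda>n. e (u n)) \<longlonglongrightarrow> e x" if "limitin T u x sequentially" for u x
    using continuous_map_limit[OF e that] by (simp add: o_def)
  obtain \<P> where P: "finite \<P>" "card \<P> = k" "\<Union>\<P> = M" "disjoint \<P>"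
    and P_open: "\<And>P. P \<in> \<P> \<Longrightarrow> openin (subtopology T M) P"
    and P_ne: "\<And>P. P \<in> \<P> \<Longrightarrow> P \<noteq> {}"
    using open_partition_of_many_components[OF comps \<open>k > 0\<close>] MT
    by (auto simp: M_def[symmetric] Int_absorb1)
  have P_disj: "P = Q" if "P \<in> \<P>" "Q \<in> \<P>" "x \<in> P" "x \<in> Q" for P Q x
    using P(4) that by (auto simp: pairwise_def disjnt_def)
  have PM: "P \<subseteq> M" if "P \<in> \<P>" for P using P(3) that by blast
  have P_saturated: "x \<in> P" if PP: "P \<in> \<P>" "y \<in> P" "x \<in> M" "e x = e y" for P x y
  proof -
    obtain U where U: "openin T U" "P = U \<inter> M"
      using P_open[OF PP(1)] by (auto simp: openin_subtopology)
    have "x \<in> U" using indist[OF _ PP(4) U(1)] PP(2,3) MT U(2) by blast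
    then show ?thesis using PP(3) U(2) by blast
  qed
  \<comment> \<open>A limit of points of \<open>P\<close> lies in \<open>M\<close>, hence in some piece \<open>Q\<close>. As \<open>Q\<close> is open in \<open>M\<close>, it
    meets \<open>P\<close>, so it is \<open>P\<close>.\<close>
  have P_limit: "x \<in> P"
    if "P \<in> \<P>" "range u \<subseteq> P" "limitin T u x sequentially" for P u x
  proof -
    have uM: "range u \<subseteq> M" using PM that by blast
    have "\<Psi> x \<le> ereal m"
    proof (rule sequentially_lsc_le_lim[OF lsc0 _ that(3)])
      show "\<Psi> (u n) \<le> ereal m" for n
      proof -
        have "u n \<in> M" using uM by blast
        then show ?thesis by (simp add: M_def)
      qed
    qed (use uM MT in auto)
    moreover have xT: "x \<in> topspace T" by (rule limitin_topspace[OF that(3)])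
    ultimately have "x \<in> M" using min[OF xT] by (auto simp: M_def)
    then obtain Q where Q: "Q \<in> \<P>" "x \<in> Q" using P(3) by blast
    then obtain U where U: "openin T U" "Q = U \<inter> M"
      using P_open[OF Q(1)] by (auto simp: openin_subtopology)
    then have "\<forall>\<^sub>F n in sequentially. u n \<in> U"
      using that(3) Q(2) by (auto simp: limitin_def)
    then obtain n where "u n \<in> U" by (auto simp: eventually_sequentially)
    then have "u n \<in> Q" using U(2) uM by blast
    then have "P = Q" using P_disj[OF that(1) Q(1)] that(2) by blast
    then show ?thesis using Q(2) by simp
  qed
  have eP_closed: "closed (e ` P)" if "P \<in> \<P>" for P
    unfolding closed_sequential_limits
  proof (intro allI impI)
    fix v a assume va: "(\<forall>n. v n \<in> e ` P) \<and> v \<longlonglongrightarrow> a"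
    then have "\<forall>n. \<exists>x. x \<in> P \<and> v n = e x" by blast
    then obtain u where u: "\<And>n. u n \<in> P" "\<And>n. v n = e (u n)" by metis
    have "P \<subseteq> {x \<in> topspace T. \<Psi> x < ereal \<rho>}"
      using PM[OF that] m_less by (auto simp: M_def)
    then have "range u \<subseteq> {x \<in> topspace T. \<Psi> x < ereal \<rho>}" using u(1) by blast
    then obtain r x where r: "strict_mono r" and x: "limitin T (u \<circ> r) x sequentially"
      using seq_comp by blast
    have "x \<in> P" by (rule P_limit[OF that _ x]) (use u(1) in auto)
    moreover have "(\<lambda>n. e ((u \<circ> r) n)) \<longlonglongrightarrow> a"
      using LIMSEQ_subseq_LIMSEQ[OF conjunct2[OF va] r] by (simp add: o_def u(2))
    ultimately show "a \<in> e ` P" using LIMSEQ_unique[OF e_lim[OF x]] by blast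
  qed
  have "\<exists>V. (\<forall>P\<in>\<P>. open (V P) \<and> e ` P \<subseteq> V P) \<and>
            (\<forall>P\<in>\<P>. \<forall>Q\<in>\<P>. P \<noteq> Q \<longrightarrow> V P \<inter> V Q = {})"
  proof (rule separate_disjoint_closed_sets[OF P(1)])
    show "e ` P \<inter> e ` Q = {}" if "P \<in> \<P>" "Q \<in> \<P>" "P \<noteq> Q" for P Q
    proof (rule ccontr)
      assume "e ` P \<inter> e ` Q \<noteq> {}"
      then obtain x y where "x \<in> P" "y \<in> Q" "e x = e y" by auto
      then show False using P_saturated[OF that(2), of y x] PM[OF that(1)] P_disj that by blast
    qed
  qed (use eP_closed P_ne in auto)
  then obtain V where V_all: "\<forall>P\<in>\<P>. open (V P) \<and> e ` P \<subseteq> V P"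
    "\<forall>P\<in>\<P>. \<forall>Q\<in>\<P>. P \<noteq> Q \<longrightarrow> V P \<inter> V Q = {}"
    by (elim exE conjE)
  have V: "open (V P)" "e ` P \<subseteq> V P" if "P \<in> \<P>" for P using V_all(1) that by simp_all
  have V_disj: "P = Q" if "P \<in> \<P>" "Q \<in> \<P>" "a \<in> V P" "a \<in> V Q" for P Q a
    using V_all(2) that by blast
  \<comment> \<open>Otherwise points outside all \<open>V P\<close> with \<open>\<Psi>\<close>-values tending to \<open>m\<close> would cluster at a
    minimiser, which lies in some open \<open>V P\<close>.\<close>
  have "\<exists>r. m < r \<and> r < \<rho> \<and> (\<forall>x\<in>topspace T. \<Psi> x \<le> ereal r \<longrightarrow> (\<exists>P\<in>\<P>. e x \<in> V P))"
  proof (rule ccontr)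
    assume no: "\<not> ?thesis"
    define c where "c = (\<lambda>n. m + (\<rho> - m) / 2 * inverse (real (Suc n)))"
    have c: "m < c n" "c n < \<rho>" for n
    proof -
      show "m < c n" using m_less by (simp add: c_def)
      have "inverse (real (Suc n)) \<le> 1" by (rule inverse_le_1_iff[THEN iffD2]) simp
      then have "(\<rho> - m) / 2 * inverse (real (Suc n)) \<le> (\<rho> - m) / 2 * 1"
        using m_less by (intro mult_left_mono) simp_all
      then show "c n < \<rho>" using m_less unfolding c_def by argo
    qed
    have "\<exists>x\<in>topspace T. \<Psi> x \<le> ereal (c n) \<and> (\<forall>P\<in>\<P>. e x \<notin> V P)" for n
      using no c[of n] by blast
    then obtain u where u: "\<And>n. u n \<in> topspace T" "\<And>n. \<Psi> (u n) \<le> ereal (c n)"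
      "\<And>n P. P \<in> \<P> \<Longrightarrow> e (u n) \<notin> V P" by metis
    have "\<Psi> (u n) < ereal \<rho>" for n
      using u(2)[of n] c(2)[of n] by (metis less_ereal.simps(1) le_less_trans)
    then have "range u \<subseteq> {x \<in> topspace T. \<Psi> x < ereal \<rho>}" using u(1) by blast
    then obtain r x where r: "strict_mono r" and x: "limitin T (u \<circ> r) x sequentially"
      using seq_comp by blast
    have c_lim: "c \<longlonglongrightarrow> m"
      using tendsto_add[OF tendsto_const[of m]
          tendsto_mult[OF tendsto_const[of "(\<rho> - m) / 2"] LIMSEQ_inverse_real_of_nat]]
      by (simp add: c_def)
    have "\<Psi> x \<le> ereal m"
    proof (rule sequentially_lsc_le_lim[OF lsc0 _ x])
      show "range (u \<circ> r) \<subseteq> topspace T" using u(1) by auto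
      show "\<Psi> ((u \<circ> r) n) \<le> ereal ((c \<circ> r) n)" for n using u(2) by simp
      show "(\<lambda>n. ereal ((c \<circ> r) n)) \<longlonglongrightarrow> ereal m"
        by (intro tendsto_ereal LIMSEQ_subseq_LIMSEQ[OF c_lim r])
    qed
    moreover have xT: "x \<in> topspace T" by (rule limitin_topspace[OF x])
    ultimately have "x \<in> M" using min[OF xT] by (auto simp: M_def)
    then obtain P where PP: "P \<in> \<P>" "x \<in> P" using P(3) by blast
    then have "e x \<in> V P" using V(2) by blast
    then have "\<forall>\<^sub>F n in sequentially. e ((u \<circ> r) n) \<in> V P"
      by (rule topological_tendstoD[OF e_lim[OF x] V(1)[OF PP(1)]])
    then obtain n where "e ((u \<circ> r) n) \<in> V P" by (auto simp: eventually_sequentially)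
    then show False using u(3)[OF PP(1)] by simp
  qed
  then obtain r where r: "m < r" "r < \<rho>"
    and cover: "\<And>x. \<lbrakk>x \<in> topspace T; \<Psi> x \<le> ereal r\<rbrakk> \<Longrightarrow> \<exists>P\<in>\<P>. e x \<in> V P"
    by blast
  define C where "C = (\<lambda>P. {x \<in> topspace T. \<Psi> x \<le> ereal r \<and> e x \<in> V P})"
  have C_rho: "C P \<subseteq> {x \<in> topspace T. \<Psi> x < ereal \<rho>}" for P
    using r(2) by (auto simp: C_def intro: le_less_trans[of _ "ereal r"])
  \<comment> \<open>The limit lies in \<open>{\<Psi> \<le> r}\<close>, hence in some open \<open>V Q\<close>, which then also contains points
    of \<open>C P\<close>; disjointness forces \<open>Q = P\<close>.\<close>
  have C_limit: "x \<in> C P" if "P \<in> \<P>" "range u \<subseteq> C P" "limitin T u x sequentially" for P u x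
  proof -
    have xT: "x \<in> topspace T" by (rule limitin_topspace[OF that(3)])
    have Psi: "\<Psi> x \<le> ereal r"
    proof (rule sequentially_lsc_le_lim[OF lsc0 _ that(3)])
      show "\<Psi> (u n) \<le> ereal r" for n
      proof -
        have "u n \<in> C P" using that(2) by blast
        then show ?thesis by (simp add: C_def)
      qed
    qed (use that(2) in \<open>auto simp: C_def\<close>)
    obtain Q where Q: "Q \<in> \<P>" "e x \<in> V Q" using cover[OF xT Psi] by blast
    then have "\<forall>\<^sub>F n in sequentially. e (u n) \<in> V Q"
      using topological_tendstoD[OF e_lim[OF that(3)] V(1)] by blast
    then obtain n where "e (u n) \<in> V Q" by (auto simp: eventually_sequentially)
    moreover have "u n \<in> C P" using that(2) by blast
    then have "e (u n) \<in> V P" by (simp add: C_def)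
    ultimately have "P = Q" using V_disj that(1) Q(1) by blast
    then show ?thesis using xT Psi Q(2) by (simp add: C_def)
  qed
  have minimiser: "\<exists>x\<in>C P. \<forall>y\<in>C P. \<Psi> x + ereal (l * \<Phi> x) \<le> \<Psi> y + ereal (l * \<Phi> y)"
    if PP: "P \<in> \<P>" "l \<in> {0..l'}" "C P \<noteq> {}" for P l
  proof -
    define F where "F = (\<lambda>x. \<Psi> x + ereal (l * \<Phi> x))"
    obtain v where v: "\<And>n. v n \<in> F ` C P" "v \<longlonglongrightarrow> Inf (F ` C P)"
      using Inf_as_limit[of "F ` C P"] PP(3) by blast
    then have "\<forall>n. \<exists>x. x \<in> C P \<and> v n = F x" by blast
    then obtain u where u: "\<And>n. u n \<in> C P" "\<And>n. v n = F (u n)" by metis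
    then have "range u \<subseteq> {x \<in> topspace T. \<Psi> x < ereal \<rho>}" using C_rho by blast
    then obtain s x where s: "strict_mono s" and x: "limitin T (u \<circ> s) x sequentially"
      using seq_comp by blast
    have "F x \<le> Inf (F ` C P)"
    proof (rule sequentially_lsc_le_lim[OF _ _ x])
      show "sequentially_lsc T F" unfolding F_def by (rule lsc[OF PP(2)])
      show "range (u \<circ> s) \<subseteq> topspace T" using u(1) by (auto simp: C_def)
      show "F ((u \<circ> s) n) \<le> (v \<circ> s) n" for n by (simp add: u(2))
      show "(v \<circ> s) \<longlonglongrightarrow> Inf (F ` C P)" by (rule LIMSEQ_subseq_LIMSEQ[OF v(2) s])
    qed
    moreover have "x \<in> C P" by (rule C_limit[OF PP(1) _ x]) (use u(1) in auto)
    ultimately show ?thesis unfolding F_def le_INF_iff by blast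
  qed
  obtain y where y: "\<And>P. P \<in> \<P> \<Longrightarrow> y P \<in> P" using P_ne by (metis ex_in_conv)
  have yC: "y P \<in> C P" "\<Psi> (y P) = ereal m" if "P \<in> \<P>" for P
    using y[OF that] PM[OF that] V(2)[OF that] r(1) by (auto simp: C_def M_def)
  define A where "A = Max ((\<lambda>P. \<Phi> (y P)) ` \<P>)"
  have A: "\<Phi> (y P) \<le> A" if "P \<in> \<P>" for P using P(1) that by (simp add: A_def)
  \<comment> \<open>This choice yields \<open>l * (A - b) < r - m\<close> for \<open>0 < l < l0\<close>, whatever the sign of \<open>A - b\<close>.\<close>
  define l0 where "l0 = min l' ((r - m) / (1 + \<bar>A - b\<bar>))"
  have "l0 > 0" using l' r by (simp add: l0_def)
  moreover have "has_at_least k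
           {x \<in> topspace T. \<Psi> x < ereal \<rho> \<and>
              local_minimum_in (sublevel_topology T \<Psi>) (\<lambda>y. \<Psi> y + ereal (l * \<Phi> y)) x}"
    (is "has_at_least k ?S") if l: "l \<in> {0<..<l0}" for l
  proof -
    have l_le: "l \<in> {0..l'}" and l_pos: "0 < l" using l by (auto simp: l0_def)
    have "l * (1 + \<bar>A - b\<bar>) < r - m"
      using l by (simp add: l0_def pos_less_divide_eq)
    moreover have "l * (A - b) \<le> l * (1 + \<bar>A - b\<bar>)"
      using l_pos by (intro mult_left_mono) auto
    ultimately have small: "l * (A - b) < r - m" by linarith
    have "\<exists>x\<in>C P. \<forall>z\<in>C P. \<Psi> x + ereal (l * \<Phi> x) \<le> \<Psi> z + ereal (l * \<Phi> z)" if "P \<in> \<P>" for P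
      using minimiser[OF that l_le] yC(1)[OF that] by blast
    then obtain x where xC: "\<And>P. P \<in> \<P> \<Longrightarrow> x P \<in> C P"
      and x_min: "\<And>P z. \<lbrakk>P \<in> \<P>; z \<in> C P\<rbrakk> \<Longrightarrow>
         \<Psi> (x P) + ereal (l * \<Phi> (x P)) \<le> \<Psi> z + ereal (l * \<Phi> z)"
      by metis
    have x_less: "\<Psi> (x P) < ereal r" if "P \<in> \<P>" for P
    proof -
      have xT: "x P \<in> topspace T" "\<Psi> (x P) < ereal \<rho>" using xC[OF that] C_rho by auto
      obtain p where p: "\<Psi> (x P) = ereal p"
        using min[OF xT(1)] xT(2) by (cases "\<Psi> (x P)") auto
      have "p + l * \<Phi> (x P) \<le> m + l * \<Phi> (y P)"
        using x_min[OF that yC(1)[OF that]] by (simp add: p yC(2)[OF that])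
      moreover have "l * \<Phi> (y P) \<le> l * A" "l * b \<le> l * \<Phi> (x P)"
        using A[OF that] below[OF xT] l_pos by simp_all
      moreover have "l * A - l * b < r - m" using small by (simp add: right_diff_distrib)
      ultimately show ?thesis by (simp add: p)
    qed
    have "x P \<in> ?S" if "P \<in> \<P>" for P
    proof -
      define U where "U = {z \<in> topspace T. \<Psi> z < ereal r} \<inter> {z \<in> topspace T. e z \<in> V P}"
      have "openin T {z \<in> topspace T. e z \<in> V P}"
        using e V(1)[OF that] by (auto simp: continuous_map_def)
      then have "openin (sublevel_topology T \<Psi>) U"
        unfolding U_def sublevel_topology_def
        by (intro openin_Int topology_generated_by_Basis) auto
      moreover have "x P \<in> U" using xC[OF that] x_less[OF that] by (simp add: U_def C_def)
      moreover have "U \<subseteq> C P" by (auto simp: U_def C_def)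
      ultimately have "local_minimum_in (sublevel_topology T \<Psi>) (\<lambda>y. \<Psi> y + ereal (l * \<Phi> y)) (x P)"
        unfolding local_minimum_in_def using x_min[OF that] by blast
      then show ?thesis using xC[OF that] C_rho by blast
    qed
    moreover have "inj_on x \<P>"
    proof (rule inj_onI)
      fix P Q assume PQ: "P \<in> \<P>" "Q \<in> \<P>" "x P = x Q"
      then have "e (x P) \<in> V P" "e (x P) \<in> V Q" using xC[of P] xC[of Q] by (auto simp: C_def)
      then show "P = Q" using V_disj PQ by blast
    qed
    ultimately show ?thesis
      unfolding has_at_least_def using P(1,2)
      by (intro exI[of _ "x ` \<P>"]) (auto simp: card_image)
  qed
  ultimately show ?thesis by blast
qed

theorem theorem6:
  fixes X :: "'a::banach set"
    and k :: nat
    and \<Phi> :: "'a \<Rightarrow> real"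
    and \<Psi> :: "'a \<Rightarrow> ereal"
    and \<rho> :: real
  assumes reflexive: "reflexive_space TYPE('a)"
    and separable: "separable_space (euclidean :: 'a topology)"
    and X_closed: "sequentially_closedin weak_topology X"
    and k_pos: "k > 0"
    and Psi_range: "\<And>x. x \<in> X \<Longrightarrow> \<Psi> x \<noteq> -\<infinity>"
    and rho: "(INF x\<in>X. \<Psi> x) < ereal \<rho>"
    and sublevel_bounded: "bounded {x \<in> X. \<Psi> x < ereal \<rho>}"
    and Phi_bounded_below: "bdd_below (\<Phi> ` (weak_topology closure_of {x \<in> X. \<Psi> x < ereal \<rho>}))"
    and lsc: "\<exists>l'>0. \<forall>l\<in>{0..l'}.
                sequentially_lsc (subtopology weak_topology X) (\<lambda>x. \<Psi> x + ereal (l * \<Phi> x))"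
    and components:
      "has_at_least k (connected_components_of
         (subtopology weak_topology {x \<in> X. \<Psi> x = (INF y\<in>X. \<Psi> y)}))"
  shows "\<exists>l\<^sub>0>0. \<forall>l\<in>{0<..<l\<^sub>0}.
           has_at_least k
             {x \<in> X. \<Psi> x < ereal \<rho> \<and>
                local_minimum_in (sublevel_topology (subtopology weak_topology X) \<Psi>)
                  (\<lambda>y. \<Psi> y + ereal (l * \<Phi> y)) x}"
proof -
  define T where "T = subtopology weak_topology X"
  have TX: "topspace T = X" by (simp add: T_def)
  define S where "S = {x \<in> X. \<Psi> x < ereal \<rho>}"
  obtain e :: "'a \<Rightarrow> nat \<Rightarrow> real" where e: "continuous_map weak_topology euclidean e"
    and e_eq: "\<And>x y f. e x = e y \<Longrightarrow> blinfun_apply (f :: 'a \<Rightarrow>\<^sub>L real) x = blinfun_apply f y"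
    and e_comp: "\<And>R. compact (e ` dual_ball R)"
    and e_lim: "\<And>R u x. \<lbrakk>range u \<subseteq> dual_ball R; (\<lambda>n. e (u n)) \<longlonglongrightarrow> e x\<rbrakk> \<Longrightarrow>
                  limitin weak_topology u x sequentially"
    using weak_coordinates_exist[OF reflexive separable] by (elim exE conjE) metis
  obtain R where R: "S \<subseteq> dual_ball R"
  proof -
    obtain R where "\<And>x. x \<in> S \<Longrightarrow> norm x \<le> R"
      using sublevel_bounded unfolding bounded_iff S_def by blast
    then have "S \<subseteq> cball 0 R" by auto
    then show ?thesis using that cball_subset_dual_ball by blast
  qed
  define M where "M = {x \<in> X. \<Psi> x = (INF y\<in>X. \<Psi> y)}"
  have "connected_components_of (subtopology weak_topology M) \<noteq> {}"
    using components k_pos unfolding has_at_least_def M_def by auto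
  then have "M \<noteq> {}" by (auto simp: connected_components_of_eq_empty)
  then obtain x0 where x0: "x0 \<in> X" "\<Psi> x0 = (INF y\<in>X. \<Psi> y)" by (auto simp: M_def)
  obtain m where m: "(INF y\<in>X. \<Psi> y) = ereal m"
    using Psi_range[OF x0(1)] rho unfolding x0(2) by (cases "INF y\<in>X. \<Psi> y") auto
  obtain b where b: "\<And>x. x \<in> S \<Longrightarrow> b \<le> \<Phi> x"
  proof -
    have "S \<subseteq> weak_topology closure_of S" by (intro closure_of_subset) simp
    then show ?thesis using Phi_bounded_below that unfolding S_def bdd_below_def by blast
  qed
  obtain l' where l': "l' > 0"
    "\<And>l. l \<in> {0..l'} \<Longrightarrow> sequentially_lsc T (\<lambda>x. \<Psi> x + ereal (l * \<Phi> x))"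
    using lsc unfolding T_def by blast
  have "\<exists>l\<^sub>0>0. \<forall>l\<in>{0<..<l\<^sub>0}. has_at_least k
           {x \<in> topspace T. \<Psi> x < ereal \<rho> \<and>
              local_minimum_in (sublevel_topology T \<Psi>) (\<lambda>y. \<Psi> y + ereal (l * \<Phi> y)) x}"
  proof (rule local_minima_from_components[OF _ _ _ l' _ _ _ _ k_pos])
    show "continuous_map T euclidean e"
      unfolding T_def by (rule continuous_map_from_subtopology[OF e])
    show "x \<in> U" if U: "x \<in> topspace T" "e x = e y" "openin T U" "y \<in> U" for x y U
    proof -
      obtain W where W: "openin weak_topology W" "U = W \<inter> X"
        using U(3) by (auto simp: T_def openin_subtopology)
      have "limitin weak_topology (\<lambda>_::nat. x) y sequentially"
        by (simp add: limitin_weak_iff e_eq[OF U(2)])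
      then have "\<forall>\<^sub>F n::nat in sequentially. x \<in> W"
        using W U(4) by (auto simp: limitin_def)
      then show ?thesis using W(2) U(1) TX by simp
    qed
    show "\<exists>r x. strict_mono (r :: nat \<Rightarrow> nat) \<and> limitin T (u \<circ> r) x sequentially"
      if u: "range u \<subseteq> {x \<in> topspace T. \<Psi> x < ereal \<rho>}" for u
    proof -
      have uS: "u n \<in> S" for n
      proof -
        have "u n \<in> {x \<in> topspace T. \<Psi> x < ereal \<rho>}" using u by blast
        then show ?thesis by (simp add: TX S_def)
      qed
      have uX: "u n \<in> X" and uR: "u n \<in> dual_ball R" for n
        using uS[of n] R by (auto simp: S_def)
      have "seq_compact (e ` dual_ball R)"
        using e_comp compact_eq_seq_compact_metric by blast
      moreover have "\<forall>n. e (u n) \<in> e ` dual_ball R" using uR by blast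
      ultimately obtain z r where z: "z \<in> e ` dual_ball R" "strict_mono r"
        "((\<lambda>n. e (u n)) \<circ> r) \<longlonglongrightarrow> z"
        by (rule seq_compactE)
      obtain x where x: "z = e x" using z(1) by blast
      have lim: "limitin weak_topology (u \<circ> r) x sequentially"
      proof (rule e_lim[of _ R])
        show "range (u \<circ> r) \<subseteq> dual_ball R" using uR by auto
        show "(\<lambda>n. e ((u \<circ> r) n)) \<longlonglongrightarrow> e x" using z(3) by (simp add: o_def x)
      qed
      moreover have "range (u \<circ> r) \<subseteq> X" using uX by auto
      ultimately have "x \<in> X"
        using X_closed unfolding sequentially_closedin_def by blast
      then have "limitin T (u \<circ> r) x sequentially"
        using lim uX by (simp add: T_def limitin_subtopology)
      then show ?thesis using z(2) by blast
    qed
    show "ereal m \<le> \<Psi> x" if "x \<in> topspace T" for x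
      unfolding m[symmetric] by (rule INF_lower) (use that TX in simp)
    show "m < \<rho>" using rho m by simp
    show "b \<le> \<Phi> x" if "x \<in> topspace T" "\<Psi> x < ereal \<rho>" for x
      using that b by (simp add: TX S_def)
    have "X \<inter> M = M" "{x \<in> topspace T. \<Psi> x = ereal m} = M"
      by (auto simp: M_def m TX)
    then have "subtopology T {x \<in> topspace T. \<Psi> x = ereal m} = subtopology weak_topology M"
      by (simp add: T_def subtopology_subtopology)
    then show "has_at_least k (connected_components_of
                  (subtopology T {x \<in> topspace T. \<Psi> x = ereal m}))"
      using components by (simp add: M_def)
  qed
  then show ?thesis unfolding TX unfolding T_def .
qed

end
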